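(* Let $\Gamma$ be an environment, $\Delta$ a type environment, $e$ evidence and $T$ a type of $\mathbf{F}_2^\mu$. If $\Gamma \vdash e : T$ and $\Delta \vdash T : *$ or $\Delta\vdash T : o$ in $\mathbf{F}_2^\mu$, then $\theta(\Gamma) \vdash |e| : \theta(T)$ in the $\lambda$-Y calculus.
   Context: System $\mathbf{F}_2^\mu$: evidence $e ::= \alpha \mid \kappa \mid \lambda\alpha.e \mid e\,e' \mid \mu\alpha.e \mid e\,T \mid \lambda x.e$; term kinds $K::=*\mid*\Rightarrow K$, kinds $k::=o\mid K$; types $T ::= F \mid x \mid \lambda x.T \mid \forall x{:}K.T \mid T\,T' \mid T \Rightarrow T'$; environments $\Gamma ::= \cdot\mid\alpha:T,\Gamma\mid\kappa:T,\Gamma$, type environments $\Delta::=\cdot\mid x:K,\Delta\mid F:K,\Delta$. Kinding: $x$/$F$ get their declared kind; $T_2\,T_1:K$ if $T_1:*$, $T_2:*\Rightarrow K$; $\lambda x.T:*\Rightarrow K$ if $\Delta,x:*\vdash T:K$ and $x\in\mathrm{FV}(T)$; $\forall x{:}K.T:o$ if $\Delta,x:K\vdash T$ has kind $o$ or $*$; $T\Rightarrow T':o$ if each of $T,T'$ has kind $o$ or $*$. Typing: declared variables/constants; (App) from $e_1:T'$, $e_2:T'\Rightarrow T$ infer $e_2\,e_1:T$; (Lam) from $\Gamma,\alpha:T'\vdash e:T$ infer $\lambda\alpha.e:T'\Rightarrow T$; (Mu) from $\Gamma,\alpha:T\vdash e:T$ infer $\mu\alpha.e:T$; (Inst) from $e:\forall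 x{:}K.T$ infer $e\,T':[T'/x]T$; (Abs) from $e:T$, $x\notin\mathrm{FV}(\Gamma)$ infer $\lambda x.e:\forall x{:}K.T$; (Conv) from $e:T$, $T\leftrightarrow_o^*T'$ infer $e:T'$, where $\to_o$ is the compatible closure of $(\lambda x.T)T'\to_o[T'/x]T$; all types are well-kinded. Erasure: $|\alpha|=\alpha$, $|\kappa|=\kappa$, $|\lambda\alpha.e|=\lambda\alpha.|e|$, $|\mu\alpha.e|=\mu\alpha.|e|$, $|e\,e'|=|e|\,|e'|$, $|\lambda x.e|=|e|$, $|e\,T|=|e|$. The $\lambda$-Y calculus: terms $e::=\alpha\mid\kappa\mid\lambda\alpha.e\mid e\,e'\mid\mu\alpha.e$, types $T::=B\mid T\Rightarrow T'$ with a single base type $B$, typed by the usual variable/constant, application, abstraction rules and the fixpoint rule (from $\Gamma,\alpha:T\vdash e:T$ infer $\Gamma\vdash\mu\alpha.e:T$). The map $\theta$: $\theta(F)=\theta(x)=B$, $\theta(\lambda x.T)=\theta(T)$, $\theta(T\,T')=\theta(T)$, $\theta(T\Rightarrow T')=\theta(T)\Rightarrow\theta(T')$, $\theta(\forall x{:}K.T)=\theta(T)$; $\theta(\Gamma)$ applies $\theta$ to every type in $\Gamma$. *)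

theory Defs
  imports Main
begin

text \<open>
  Bound and free variables are de Bruijn indices, with separate index spaces for type variables
  and for evidence variables, so that alpha-equivalent expressions are equal. Constants carry
  names from arbitrary types (\<open>'f\<close> for type constants, \<open>'c\<close> for evidence constants).
  An environment is a pair: the declarations of constants, as an association list, and the
  declarations of variables, where entry \<open>i\<close> belongs to index \<open>i\<close>.
\<close>

subsection \<open>Kinds and types\<close>

datatype tkind = Star | StarTo tkind

datatype kind = KO | KT tkind

datatype 'f ty =
    TConst 'f
  | TVar nat
  | TLam "'f ty"
  | TAll tkind "'f ty"
  | TApp "'f ty" "'f ty"
  | TImp "'f ty" "'f ty"

type_synonym 'f tyenv = "('f \<times> tkind) list \<times> tkind list"

primrec FV :: "'f ty \<Rightarrow> nat set" where
  "FV (TConst F) = {}"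
| "FV (TVar i) = {i}"
| "FV (TLam T) = {i. Suc i \<in> FV T}"
| "FV (TAll K T) = {i. Suc i \<in> FV T}"
| "FV (TApp T T') = FV T \<union> FV T'"
| "FV (TImp T T') = FV T \<union> FV T'"

text \<open>\<open>lift T n\<close> makes room for a new type variable with index \<open>n\<close>.\<close>

primrec lift :: "'f ty \<Rightarrow> nat \<Rightarrow> 'f ty" where
  "lift (TConst F) n = TConst F"
| "lift (TVar i) n = (if i < n then TVar i else TVar (Suc i))"
| "lift (TLam T) n = TLam (lift T (Suc n))"
| "lift (TAll K T) n = TAll K (lift T (Suc n))"
| "lift (TApp T T') n = TApp (lift T n) (lift T' n)"
| "lift (TImp T T') n = TImp (lift T n) (lift T' n)"

text \<open>
  \<open>subst T S n\<close> replaces the variable with index \<open>n\<close> by \<open>S\<close> and removes this index; hence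
  \<open>subst T S 0\<close> is the result of instantiating, in the body \<open>T\<close> of a binder, the bound
  variable by \<open>S\<close>.
\<close>

primrec subst :: "'f ty \<Rightarrow> 'f ty \<Rightarrow> nat \<Rightarrow> 'f ty" where
  "subst (TConst F) S n = TConst F"
| "subst (TVar i) S n = (if n < i then TVar (i - 1) else if i = n then S else TVar i)"
| "subst (TLam T) S n = TLam (subst T (lift S 0) (Suc n))"
| "subst (TAll K T) S n = TAll K (subst T (lift S 0) (Suc n))"
| "subst (TApp T T') S n = TApp (subst T S n) (subst T' S n)"
| "subst (TImp T T') S n = TImp (subst T S n) (subst T' S n)"

inductive kinding :: "'f tyenv \<Rightarrow> 'f ty \<Rightarrow> kind \<Rightarrow> bool"
  ("_ \<turnstile>\<^sub>k _ : _" [51, 51, 51] 50) where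
  KVar: "i < length D \<Longrightarrow> (C, D) \<turnstile>\<^sub>k TVar i : KT (D ! i)"
| KConst: "map_of C F = Some K \<Longrightarrow> (C, D) \<turnstile>\<^sub>k TConst F : KT K"
| KApp: "\<Delta> \<turnstile>\<^sub>k T\<^sub>1 : KT Star \<Longrightarrow> \<Delta> \<turnstile>\<^sub>k T\<^sub>2 : KT (StarTo K) \<Longrightarrow> \<Delta> \<turnstile>\<^sub>k TApp T\<^sub>2 T\<^sub>1 : KT K"
| KLam: "(C, Star # D) \<turnstile>\<^sub>k T : KT K \<Longrightarrow> 0 \<in> FV T \<Longrightarrow> (C, D) \<turnstile>\<^sub>k TLam T : KT (StarTo K)"
| KAll: "(C, K # D) \<turnstile>\<^sub>k T : k \<Longrightarrow> k = KO \<or> k = KT Star \<Longrightarrow> (C, D) \<turnstile>\<^sub>k TAll K T : KO"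
| KImp: "\<Delta> \<turnstile>\<^sub>k T : k \<Longrightarrow> k = KO \<or> k = KT Star \<Longrightarrow>
    \<Delta> \<turnstile>\<^sub>k T' : k' \<Longrightarrow> k' = KO \<or> k' = KT Star \<Longrightarrow> \<Delta> \<turnstile>\<^sub>k TImp T T' : KO"

definition well_kinded :: "'f tyenv \<Rightarrow> 'f ty \<Rightarrow> bool" where
  "well_kinded \<Delta> T \<longleftrightarrow> (\<exists>k. \<Delta> \<turnstile>\<^sub>k T : k)"

inductive beta :: "'f ty \<Rightarrow> 'f ty \<Rightarrow> bool" (infix "\<rightarrow>\<^sub>o" 50) where
  beta: "TApp (TLam T) T' \<rightarrow>\<^sub>o subst T T' 0"
| lam: "T \<rightarrow>\<^sub>o T' \<Longrightarrow> TLam T \<rightarrow>\<^sub>o TLam T'"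
| all: "T \<rightarrow>\<^sub>o T' \<Longrightarrow> TAll K T \<rightarrow>\<^sub>o TAll K T'"
| appL: "T \<rightarrow>\<^sub>o T' \<Longrightarrow> TApp T U \<rightarrow>\<^sub>o TApp T' U"
| appR: "T \<rightarrow>\<^sub>o T' \<Longrightarrow> TApp U T \<rightarrow>\<^sub>o TApp U T'"
| impL: "T \<rightarrow>\<^sub>o T' \<Longrightarrow> TImp T U \<rightarrow>\<^sub>o TImp T' U"
| impR: "T \<rightarrow>\<^sub>o T' \<Longrightarrow> TImp U T \<rightarrow>\<^sub>o TImp U T'"

text \<open>Conversion is on raw types: intermediate types need not be well-kinded.\<close>

abbreviation conv :: "'f ty \<Rightarrow> 'f ty \<Rightarrow> bool" (infix "\<leftrightarrow>\<^sub>o" 50) where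
  "T \<leftrightarrow>\<^sub>o T' \<equiv> equivclp beta T T'"

subsection \<open>Evidence\<close>

datatype ('f, 'c) ev =
    EVar nat
  | EConst 'c
  | ELam "('f, 'c) ev"
  | EApp "('f, 'c) ev" "('f, 'c) ev"
  | EMu "('f, 'c) ev"
  | EInst "('f, 'c) ev" "'f ty"
  | EAbs "('f, 'c) ev" \<comment> \<open>binds a type variable\<close>

text \<open>Generic in the type \<open>'t\<close> of types, since it is used for both calculi.\<close>

type_synonym ('c, 't) env = "('c \<times> 't) list \<times> 't list"

definition map_env :: "('t \<Rightarrow> 'u) \<Rightarrow> ('c, 't) env \<Rightarrow> ('c, 'u) env" where
  "map_env f \<Gamma> = (map (map_prod id f) (fst \<Gamma>), map f (snd \<Gamma>))"

definition well_kinded_env :: "'f tyenv \<Rightarrow> ('c, 'f ty) env \<Rightarrow> bool" where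
  "well_kinded_env \<Delta> \<Gamma> \<longleftrightarrow>
     (\<forall>T \<in> snd ` set (fst \<Gamma>) \<union> set (snd \<Gamma>). well_kinded \<Delta> T)"

text \<open>
  The type environment is explicit in the judgement. The convention that all types are
  well-kinded is enforced by the premises mentioning \<open>\<Delta>\<close>; lemma \<open>typing_well_kinded\<close> below
  shows that they suffice. In rule \<open>Abs\<close>, the lifted environment does not contain the type
  variable with index 0, which is the side condition that the abstracted variable is not free
  in the environment.
\<close>

inductive typing :: "'f tyenv \<Rightarrow> ('c, 'f ty) env \<Rightarrow> ('f, 'c) ev \<Rightarrow> 'f ty \<Rightarrow> bool"
  ("_; _ \<turnstile> _ : _" [51, 51, 51, 51] 50) where
  Var: "well_kinded_env \<Delta> (C, G) \<Longrightarrow> i < length G \<Longrightarrow> \<Delta>; (C, G) \<turnstile> EVar i : G ! i"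
| Const: "well_kinded_env \<Delta> (C, G) \<Longrightarrow> map_of C c = Some T \<Longrightarrow> \<Delta>; (C, G) \<turnstile> EConst c : T"
| App: "\<Delta>; \<Gamma> \<turnstile> e\<^sub>1 : T' \<Longrightarrow> \<Delta>; \<Gamma> \<turnstile> e\<^sub>2 : TImp T' T \<Longrightarrow> \<Delta>; \<Gamma> \<turnstile> EApp e\<^sub>2 e\<^sub>1 : T"
| Lam: "\<Delta>; (C, T' # G) \<turnstile> e : T \<Longrightarrow> well_kinded \<Delta> (TImp T' T) \<Longrightarrow>
    \<Delta>; (C, G) \<turnstile> ELam e : TImp T' T"
| Mu: "\<Delta>; (C, T # G) \<turnstile> e : T \<Longrightarrow> \<Delta>; (C, G) \<turnstile> EMu e : T"
| Inst: "\<Delta>; \<Gamma> \<turnstile> e : TAll K T \<Longrightarrow> \<Delta> \<turnstile>\<^sub>k T' : KT K \<Longrightarrow>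
    \<Delta>; \<Gamma> \<turnstile> EInst e T' : subst T T' 0"
| Abs: "(C, K # D); map_env (\<lambda>U. lift U 0) \<Gamma> \<turnstile> e : T \<Longrightarrow> well_kinded_env (C, D) \<Gamma> \<Longrightarrow>
    well_kinded (C, D) (TAll K T) \<Longrightarrow> (C, D); \<Gamma> \<turnstile> EAbs e : TAll K T"
| Conv: "\<Delta>; \<Gamma> \<turnstile> e : T \<Longrightarrow> T \<leftrightarrow>\<^sub>o T' \<Longrightarrow> well_kinded \<Delta> T' \<Longrightarrow> \<Delta>; \<Gamma> \<turnstile> e : T'"

subsection \<open>The lambda-Y calculus\<close>

datatype 'c lyterm =
    LVar nat
  | LConst 'c
  | LLam "'c lyterm"
  | LApp "'c lyterm" "'c lyterm"
  | LMu "'c lyterm"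

datatype lyty = B | Fun lyty lyty

inductive ly_typing :: "('c, lyty) env \<Rightarrow> 'c lyterm \<Rightarrow> lyty \<Rightarrow> bool"
  ("_ \<turnstile>\<^sub>Y _ : _" [51, 51, 51] 50) where
  YVar: "i < length G \<Longrightarrow> (C, G) \<turnstile>\<^sub>Y LVar i : G ! i"
| YConst: "map_of C c = Some T \<Longrightarrow> (C, G) \<turnstile>\<^sub>Y LConst c : T"
| YApp: "\<Gamma> \<turnstile>\<^sub>Y e\<^sub>1 : T' \<Longrightarrow> \<Gamma> \<turnstile>\<^sub>Y e\<^sub>2 : Fun T' T \<Longrightarrow> \<Gamma> \<turnstile>\<^sub>Y LApp e\<^sub>2 e\<^sub>1 : T"
| YLam: "(C, T' # G) \<turnstile>\<^sub>Y e : T \<Longrightarrow> (C, G) \<turnstile>\<^sub>Y LLam e : Fun T' T"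
| YMu: "(C, T # G) \<turnstile>\<^sub>Y e : T \<Longrightarrow> (C, G) \<turnstile>\<^sub>Y LMu e : T"

subsection \<open>The translation\<close>

primrec erase :: "('f, 'c) ev \<Rightarrow> 'c lyterm" where
  "erase (EVar i) = LVar i"
| "erase (EConst c) = LConst c"
| "erase (ELam e) = LLam (erase e)"
| "erase (EMu e) = LMu (erase e)"
| "erase (EApp e e') = LApp (erase e) (erase e')"
| "erase (EAbs e) = erase e"
| "erase (EInst e T) = erase e"

primrec theta :: "'f ty \<Rightarrow> lyty" where
  "theta (TConst F) = B"
| "theta (TVar i) = B"
| "theta (TLam T) = theta T"
| "theta (TApp T T') = theta T"
| "theta (TImp T T') = Fun (theta T) (theta T')"
| "theta (TAll K T) = theta T"

definition theta_env :: "('c, 'f ty) env \<Rightarrow> ('c, lyty) env" where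
  "theta_env = map_env theta"

subsection \<open>Typing involves only well-kinded types\<close>

lemma FV_lift_below: "m \<in> FV T \<Longrightarrow> m < n \<Longrightarrow> m \<in> FV (lift T n)"
  by (induction T arbitrary: m n) auto

lemma FV_subst_below: "m \<in> FV T \<Longrightarrow> m < n \<Longrightarrow> m \<in> FV (subst T S n)"
  by (induction T arbitrary: m n S) auto

lemma kinding_lift:
  "(C, D) \<turnstile>\<^sub>k T : k \<Longrightarrow> n \<le> length D \<Longrightarrow> (C, take n D @ K # drop n D) \<turnstile>\<^sub>k lift T n : k"
proof (induction "(C, D)" T k arbitrary: D n rule: kinding.induct)
  case (KVar i D)
  let ?D = "take n D @ K # drop n D"
  show ?case
  proof (cases "i < n")
    case True
    then have "i < length ?D" "?D ! i = D ! i"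
      using KVar by (auto simp: nth_append)
    with True show ?thesis
      using kinding.KVar[of i ?D C] by simp
  next
    case False
    then have "Suc i < length ?D" "?D ! Suc i = D ! i"
      using KVar by (auto simp: nth_append Suc_diff_le)
    with False show ?thesis
      using kinding.KVar[of "Suc i" ?D C] by simp
  qed
next
  case (KLam D T k)
  have "0 \<in> FV (lift T (Suc n))"
    using KLam(3) by (simp add: FV_lift_below)
  then show ?case
    using KLam(2)[of "Suc n"] KLam(4) by (auto intro: kinding.KLam)
next
  case (KAll K' D T k)
  then show ?case
    using KAll(2)[of "Suc n"] by (auto intro: kinding.KAll)
qed (auto intro: kinding.intros)

lemma kinding_subst:
  "(C, E) \<turnstile>\<^sub>k T : k \<Longrightarrow> E = D @ K # D' \<Longrightarrow> (C, D @ D') \<turnstile>\<^sub>k S : KT K \<Longrightarrow>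
    (C, D @ D') \<turnstile>\<^sub>k subst T S (length D) : k"
proof (induction "(C, E)" T k arbitrary: E D S rule: kinding.induct)
  case (KVar i E)
  consider "i < length D" | "i = length D" | "length D < i"
    by linarith
  then show ?case
  proof cases
    case 3
    then have "i - 1 < length (D @ D')" "(D @ D') ! (i - 1) = E ! i"
      using KVar by (auto simp: nth_append nth_Cons')
    with 3 show ?thesis
      using kinding.KVar[of "i - 1" "D @ D'" C] by simp
  qed (use KVar kinding.KVar[of i "D @ D'" C] in \<open>auto simp: nth_append\<close>)
next
  case (KLam E T k)
  have "(C, (Star # D) @ D') \<turnstile>\<^sub>k lift S 0 : KT K"
    using kinding_lift[OF KLam(5), of 0] by simp
  from KLam(2)[OF _ this] KLam(3,4) show ?case
    by (auto intro!: kinding.KLam FV_subst_below)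
next
  case (KAll K' E T k)
  have "(C, (K' # D) @ D') \<turnstile>\<^sub>k lift S 0 : KT K"
    using kinding_lift[OF KAll(5), of 0] by simp
  from KAll(2)[OF _ this] KAll(3,4) show ?case
    by (auto intro: kinding.KAll)
next
  case (KApp E T\<^sub>1 T\<^sub>2 k)
  then show ?case
    unfolding subst.simps by (blast intro: kinding.KApp)
next
  case (KImp E T k T' k')
  then show ?case
    unfolding subst.simps by (blast intro: kinding.KImp)
qed (auto intro: kinding.intros)

lemma typing_well_kinded:
  "\<Delta>; \<Gamma> \<turnstile> e : T \<Longrightarrow> well_kinded_env \<Delta> \<Gamma> \<and> well_kinded \<Delta> T"
proof (induction rule: typing.induct)
  case (Const \<Delta> C G c T)
  then show ?case
    by (force simp: well_kinded_env_def dest: map_of_SomeD)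
next
  case (App \<Delta> \<Gamma> e\<^sub>1 T' e\<^sub>2 T)
  then show ?case
    by (auto simp: well_kinded_def elim: kinding.cases)
next
  case (Inst \<Delta> \<Gamma> e K T T')
  obtain C D where \<Delta>: "\<Delta> = (C, D)"
    by fastforce
  from Inst.IH obtain k where "(C, K # D) \<turnstile>\<^sub>k T : k"
    by (auto simp: well_kinded_def \<Delta> elim: kinding.cases)
  from kinding_subst[OF this, of "[]" K D T'] Inst show ?case
    by (auto simp: well_kinded_def \<Delta>)
qed (auto simp: well_kinded_env_def)

end

theory Submission imports Defs "HOL-Library.Confluence" begin

text \<open>
  The map \<open>theta\<close> sends every type of a kind \<open>KT K\<close> to \<open>B\<close>, so it is unchanged by substituting such
  a type for a variable, and hence by a reduction step from a well-kinded type. Conversion may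
  however pass through ill-kinded types, on which \<open>theta\<close> is not invariant. By confluence of raw
  reduction two convertible types have a common reduct, and if both are well-kinded, then so are
  all types on the two reduction sequences: reduction preserves kinds, where the condition
  \<open>0 \<in> FV T\<close> in \<open>KLam\<close> survives because a well-kinded redex never discards its argument.
\<close>

subsection \<open>Confluence of type reduction\<close>

lemma lift_lift: "i \<le> k \<Longrightarrow> lift (lift T i) (Suc k) = lift (lift T k) i"
  by (induction T arbitrary: i k) auto

lemma lift_subst_below: "j \<le> i \<Longrightarrow> lift (subst T S j) i = subst (lift T (Suc i)) (lift S i) j"
  by (induction T arbitrary: i j S) (auto simp: lift_lift)

lemma lift_subst_above: "i \<le> j \<Longrightarrow> lift (subst T S j) i = subst (lift T i) (lift S i) (Suc j)"
  by (induction T arbitrary: i j S) (auto simp: lift_lift)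

lemma subst_lift [simp]: "subst (lift T n) S n = T"
  by (induction T arbitrary: n S) auto

text \<open>The substitution lemma. On the left \<open>V\<close> goes in first, while index
  \<open>i\<close> is still occupied, hence \<open>Suc j\<close> and
  \<open>lift V i\<close>.\<close>

lemma subst_subst:
  "i \<le> j \<Longrightarrow> subst (subst T (lift V i) (Suc j)) (subst U V j) i = subst (subst T U i) V j"
  by (induction T arbitrary: i j U V) (auto simp: lift_lift[symmetric] lift_subst_above)

text \<open>Parallel reduction in the style of Tait and Martin-Loef: any chosen redexes of a type
  are contracted in one step, which gives the diamond property that \<open>beta\<close>
  lacks.\<close>

inductive par_beta :: "'f ty \<Rightarrow> 'f ty \<Rightarrow> bool" (infix "\<Rrightarrow>\<^sub>o" 50) where
  const: "TConst F \<Rrightarrow>\<^sub>o TConst F"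
| var: "TVar i \<Rrightarrow>\<^sub>o TVar i"
| lam: "T \<Rrightarrow>\<^sub>o T' \<Longrightarrow> TLam T \<Rrightarrow>\<^sub>o TLam T'"
| all: "T \<Rrightarrow>\<^sub>o T' \<Longrightarrow> TAll K T \<Rrightarrow>\<^sub>o TAll K T'"
| app: "T \<Rrightarrow>\<^sub>o T' \<Longrightarrow> U \<Rrightarrow>\<^sub>o U' \<Longrightarrow> TApp T U \<Rrightarrow>\<^sub>o TApp T' U'"
| imp: "T \<Rrightarrow>\<^sub>o T' \<Longrightarrow> U \<Rrightarrow>\<^sub>o U' \<Longrightarrow> TImp T U \<Rrightarrow>\<^sub>o TImp T' U'"
| beta: "T \<Rrightarrow>\<^sub>o T' \<Longrightarrow> U \<Rrightarrow>\<^sub>o U' \<Longrightarrow> TApp (TLam T) U \<Rrightarrow>\<^sub>o subst T' U' 0"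

inductive_cases par_beta_TLamE: "TLam T \<Rrightarrow>\<^sub>o U"

lemma par_beta_refl [simp]: "T \<Rrightarrow>\<^sub>o T"
  by (induction T) (auto intro: par_beta.intros)

lemma par_beta_lift: "T \<Rrightarrow>\<^sub>o T' \<Longrightarrow> lift T n \<Rrightarrow>\<^sub>o lift T' n"
  by (induction arbitrary: n rule: par_beta.induct)
    (auto intro: par_beta.intros simp: lift_subst_below)

lemma par_beta_subst: "T \<Rrightarrow>\<^sub>o T' \<Longrightarrow> S \<Rrightarrow>\<^sub>o S' \<Longrightarrow> subst T S n \<Rrightarrow>\<^sub>o subst T' S' n"
proof (induction arbitrary: n S S' rule: par_beta.induct)
  case (beta T T' U U')
  then have "TApp (TLam (subst T (lift S 0) (Suc n))) (subst U S n) \<Rrightarrow>\<^sub>o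
      subst (subst T' (lift S' 0) (Suc n)) (subst U' S' n) 0"
    by (intro par_beta.beta) (auto intro: par_beta_lift)
  then show ?case
    by (simp add: subst_subst)
qed (simp_all add: par_beta.lam par_beta.all par_beta.app par_beta.imp par_beta_lift)

text \<open>Takahashi's complete development.\<close>

fun develop :: "'f ty \<Rightarrow> 'f ty" where
  "develop (TConst F) = TConst F"
| "develop (TVar i) = TVar i"
| "develop (TLam T) = TLam (develop T)"
| "develop (TAll K T) = TAll K (develop T)"
| "develop (TApp (TLam T) U) = subst (develop T) (develop U) 0"
| "develop (TApp T U) = TApp (develop T) (develop U)"
| "develop (TImp T U) = TImp (develop T) (develop U)"

text \<open>\<open>develop T\<close> contracts every redex of \<open>T\<close>, so whatever a
  parallel step left out can still be contracted.\<close>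

lemma par_beta_develop: "T \<Rrightarrow>\<^sub>o T' \<Longrightarrow> T' \<Rrightarrow>\<^sub>o develop T"
proof (induction rule: par_beta.induct)
  case (app T T' U U')
  show ?case
  \<comment> \<open>Only when \<open>T\<close> is a lambda does \<open>develop\<close> contract the
    application itself.\<close>
  proof (cases "\<exists>V. T = TLam V")
    case True
    with app show ?thesis
      by (auto elim!: par_beta_TLamE intro: par_beta.beta)
  next
    case False
    then have "develop (TApp T U) = TApp (develop T) (develop U)"
      by (cases T) auto
    with app show ?thesis
      by (simp add: par_beta.app)
  qed
qed (auto intro: par_beta.intros par_beta_subst)

lemma beta_imp_par_beta: "T \<rightarrow>\<^sub>o T' \<Longrightarrow> T \<Rrightarrow>\<^sub>o T'"
  by (induction rule: beta.induct) (auto intro: par_beta.intros)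

lemma beta_rtranclp_context:
  assumes "beta\<^sup>*\<^sup>* T T'" and "\<And>U U'. U \<rightarrow>\<^sub>o U' \<Longrightarrow> f U \<rightarrow>\<^sub>o f U'"
  shows "beta\<^sup>*\<^sup>* (f T) (f T')"
  using assms(1) by induction (auto intro: assms(2) rtranclp.rtrancl_into_rtrancl)

lemma beta_rtranclp_app:
  assumes "beta\<^sup>*\<^sup>* T T'" "beta\<^sup>*\<^sup>* U U'"
  shows "beta\<^sup>*\<^sup>* (TApp T U) (TApp T' U')"
  by (rule rtranclp_trans)
    (rule beta_rtranclp_context[where f = "\<lambda>T. TApp T U", OF assms(1) beta.appL],
      assumption, rule beta_rtranclp_context[OF assms(2) beta.appR])

lemma beta_rtranclp_imp:
  assumes "beta\<^sup>*\<^sup>* T T'" "beta\<^sup>*\<^sup>* U U'"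
  shows "beta\<^sup>*\<^sup>* (TImp T U) (TImp T' U')"
  by (rule rtranclp_trans)
    (rule beta_rtranclp_context[where f = "\<lambda>T. TImp T U", OF assms(1) beta.impL],
      assumption, rule beta_rtranclp_context[OF assms(2) beta.impR])

lemma par_beta_imp_rtranclp: "T \<Rrightarrow>\<^sub>o T' \<Longrightarrow> beta\<^sup>*\<^sup>* T T'"
proof (induction rule: par_beta.induct)
  case (beta T T' U U')
  then have "beta\<^sup>*\<^sup>* (TApp (TLam T) U) (TApp (TLam T') U')"
    by (intro beta_rtranclp_app beta_rtranclp_context[where f = TLam] beta.lam)
  then show ?case
    by (rule rtranclp.rtrancl_into_rtrancl) (rule beta.beta)
qed (auto intro: beta_rtranclp_app beta_rtranclp_imp beta_rtranclp_context beta.lam beta.all)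

lemma par_beta_rtranclp: "par_beta\<^sup>*\<^sup>* = (beta\<^sup>*\<^sup>* :: 'f ty \<Rightarrow> 'f ty \<Rightarrow> bool)"
  by (rule rtranclp_subset) (auto intro: beta_imp_par_beta par_beta_imp_rtranclp)

lemma confluentp_beta: "confluentp (beta :: 'f ty \<Rightarrow> 'f ty \<Rightarrow> bool)"
proof -
  \<comment> \<open>Two parallel reducts of the same \<open>T\<close> meet at
    \<open>develop T\<close>.\<close>
  have "strong_confluentp (par_beta :: 'f ty \<Rightarrow> 'f ty \<Rightarrow> bool)"
    by (rule strong_confluentpI) (blast dest: par_beta_develop)
  then have "confluentp (par_beta :: 'f ty \<Rightarrow> 'f ty \<Rightarrow> bool)"
    by (rule strong_confluentp_imp_confluentp)
  then show ?thesis
    by (simp add: confluentp_def par_beta_rtranclp rtranclp_conversep)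
qed

lemma church_rosser:
  assumes "T \<leftrightarrow>\<^sub>o T'"
  obtains U where "beta\<^sup>*\<^sup>* T U" "beta\<^sup>*\<^sup>* T' U"
  using assms
  \<comment> \<open>Semiconfluence turns a conversion into a reduction followed by a reversed
    reduction.\<close>
  unfolding semiconfluentp_equivclp[OF confluentp_imp_semiconfluentp[OF confluentp_beta]]
  by (auto simp: rtranclp_conversep)

subsection \<open>Reduction of well-kinded types\<close>

lemma FV_lift_above: "m \<in> FV T \<Longrightarrow> n \<le> m \<Longrightarrow> Suc m \<in> FV (lift T n)"
  by (induction T arbitrary: m n) auto

lemma FV_subst_above: "Suc m \<in> FV T \<Longrightarrow> n \<le> m \<Longrightarrow> m \<in> FV (subst T S n)"
  by (induction T arbitrary: m n S) auto

lemma FV_subst_same: "n \<in> FV T \<Longrightarrow> m \<in> FV S \<Longrightarrow> m \<in> FV (subst T S n)"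
  by (induction T arbitrary: m n S) (auto simp: FV_lift_above)

lemma theta_lift [simp]: "theta (lift T n) = theta T"
  by (induction T arbitrary: n) auto

lemma theta_subst: "theta S = B \<Longrightarrow> theta (subst T S n) = theta T"
  by (induction T arbitrary: S n) auto

text \<open>\<open>theta\<close> follows the function part of an application and the body of a
  lambda; implications and quantified types only have kind \<open>KO\<close>, so it ends at a
  variable or constant.\<close>

lemma theta_KT: "\<Delta> \<turnstile>\<^sub>k T : KT K \<Longrightarrow> theta T = B"
  by (induction \<Delta> T "KT K" arbitrary: K rule: kinding.induct) auto

inductive_cases kinding_TLamE: "\<Delta> \<turnstile>\<^sub>k TLam T : k"
inductive_cases kinding_TAllE: "\<Delta> \<turnstile>\<^sub>k TAll K T : k"
inductive_cases kinding_TAppE: "\<Delta> \<turnstile>\<^sub>k TApp T U : k"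
inductive_cases kinding_TImpE: "\<Delta> \<turnstile>\<^sub>k TImp T U : k"

text \<open>The claims are proved together: the inclusion of free variables restores the side
  condition of \<open>KLam\<close>, and it holds at a redex because the bound variable occurs in the
  body.\<close>

lemma beta_kinding:
  "T \<rightarrow>\<^sub>o T' \<Longrightarrow> \<Delta> \<turnstile>\<^sub>k T : k \<Longrightarrow> \<Delta> \<turnstile>\<^sub>k T' : k \<and> FV T \<subseteq> FV T' \<and> theta T' = theta T"
proof (induction arbitrary: \<Delta> k rule: beta.induct)
  case (beta T S)
  obtain C D K where \<Delta>: "\<Delta> = (C, D)" and k: "k = KT K" and S: "(C, D) \<turnstile>\<^sub>k S : KT Star"
    and T: "(C, Star # D) \<turnstile>\<^sub>k T : KT K" and FV: "0 \<in> FV T"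
    using beta by (auto elim!: kinding_TAppE kinding_TLamE)
  \<comment> \<open>The empty prefix places the substitution at index
    \<open>length [] = 0\<close>.\<close>
  have "(C, D) \<turnstile>\<^sub>k subst T S 0 : KT K"
    using kinding_subst[OF T, of "[]" Star D S] S by simp
  then show ?case
    using FV theta_KT[OF S] by (auto simp: \<Delta> k FV_subst_above FV_subst_same theta_subst)
next
  case (lam T T')
  then show ?case
    by (fastforce elim!: kinding_TLamE intro!: kinding.KLam)
next
  case (all T T' K)
  then show ?case
    by (fastforce elim!: kinding_TAllE intro!: kinding.KAll)
next
  case (appL T T' U)
  then show ?case
    by (fastforce elim!: kinding_TAppE intro: kinding.KApp)
next
  case (appR T T' U)
  then show ?case
    by (fastforce elim!: kinding_TAppE intro: kinding.KApp)
next
  case (impL T T' U)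
  then show ?case
    by (fastforce elim!: kinding_TImpE intro: kinding.KImp)
next
  case (impR T T' U)
  then show ?case
    by (fastforce elim!: kinding_TImpE intro: kinding.KImp)
qed

lemma beta_rtranclp_theta:
  assumes "beta\<^sup>*\<^sup>* T T'" and "\<Delta> \<turnstile>\<^sub>k T : k"
  shows "theta T' = theta T"
proof -
  from assms have "\<Delta> \<turnstile>\<^sub>k T' : k \<and> theta T' = theta T"
    by induction (auto dest: beta_kinding)
  then show ?thesis ..
qed

lemma conv_theta:
  assumes "T \<leftrightarrow>\<^sub>o T'" and "well_kinded \<Delta> T" and "well_kinded \<Delta> T'"
  shows "theta T = theta T'"
  using assms by (auto simp: well_kinded_def elim!: church_rosser dest!: beta_rtranclp_theta)

subsection \<open>The translation preserves typing\<close>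

lemma theta_env_Pair:
  "theta_env (C, G) = (map (\<lambda>(c, T). (c, theta T)) C, map theta G)"
  by (simp add: theta_env_def map_env_def map_prod_def)

text \<open>Serves \<open>Abs\<close>, where erasure drops the binder but the environment was
  lifted.\<close>

lemma theta_env_lift [simp]: "theta_env (map_env (\<lambda>U. lift U n) \<Gamma>) = theta_env \<Gamma>"
  by (simp add: theta_env_def map_env_def o_def prod.map_comp map_prod_def split_def)

lemma typing_erase: "\<Delta>; \<Gamma> \<turnstile> e : T \<Longrightarrow> theta_env \<Gamma> \<turnstile>\<^sub>Y erase e : theta T"
proof (induction rule: typing.induct)
  case (Var \<Delta> C G i)
  then show ?case
    using YVar[of i "map theta G" "map (\<lambda>(c, T). (c, theta T)) C"] by (simp add: theta_env_Pair)
next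
  case (Inst \<Delta> \<Gamma> e K T T')
  \<comment> \<open>\<open>T'\<close> has kind \<open>KT K\<close>, so \<open>theta\<close> maps it
    to \<open>B\<close>, like the variable it replaces.\<close>
  then show ?case
    by (simp add: theta_subst theta_KT)
next
  case (Conv \<Delta> \<Gamma> e T T')
  \<comment> \<open>\<open>typing_well_kinded\<close> covers \<open>T\<close>; for \<open>T'\<close>
    well-kindedness is a premise of \<open>Conv\<close>.\<close>
  then show ?case
    using typing_well_kinded[OF Conv.hyps(1)] by (metis conv_theta)
qed (auto intro: ly_typing.intros simp: theta_env_Pair map_of_map)

theorem theorem28:
  fixes \<Delta> :: "'f tyenv" and \<Gamma> :: "('c, 'f ty) env" and e :: "('f, 'c) ev" and T :: "'f ty"
  assumes "\<Delta>; \<Gamma> \<turnstile> e : T"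
    and "\<Delta> \<turnstile>\<^sub>k T : KT Star \<or> \<Delta> \<turnstile>\<^sub>k T : KO"
  shows "theta_env \<Gamma> \<turnstile>\<^sub>Y erase e : theta T"
  using assms(1) by (rule typing_erase)

end
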